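(* Let $\ell\in\mathbb{N}$. Suppose $\mathfrak{g}\in H^{\ell}$ satisfies $\operatorname{div}^{k}\mathfrak{g}_{n}>0$ for all $n\geq\ell-k$ and all $0\leq k<\ell$. Then for all $u\in\mathcal{H}_{0}^{\ell}$ we have the identity $$\sum_{n=\lceil\ell/2\rceil}^{\infty}\left|(-\Delta)^{\ell/2}u_{n}\right|^{2}=\sum_{n=\ell}^{\infty}\frac{(-\Delta)^{\ell}\mathfrak{g}_{n}}{\mathfrak{g}_{n}}\,|u_{n}|^{2}+\sum_{k=0}^{\ell-1}\mathcal{R}_{k}^{(\ell)}(\mathfrak{g};u),$$ where $$\mathcal{R}_{k}^{(\ell)}(\mathfrak{g};u):=\sum_{n=\ell-k}^{\infty}\frac{(-\Delta)^{\ell-1-k}\operatorname{div}^{k+1}\mathfrak{g}_{n}}{\operatorname{div}^{k+1}\mathfrak{g}_{n}}\left|\sqrt{\frac{\operatorname{div}^{k}\mathfrak{g}_{n}}{\operatorname{div}^{k}\mathfrak{g}_{n+1}}}\,\operatorname{div}^{k}u_{n+1}-\sqrt{\frac{\operatorname{div}^{k}\mathfrak{g}_{n+1}}{\operatorname{div}^{k}\mathfrak{g}_{n}}}\,\operatorname{div}^{k}u_{n}\right|^{2},$$ and for $k=\ell-1$ the coefficient in front of the absolute value is interpreted as $1$.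
   Context: $\mathbb{N}=\{1,2,\dots\}$. All sequences are complex sequences indexed by $\mathbb{Z}$. Difference operators on such sequences: $(\nabla u)_{n}:=u_{n}-u_{n-1}$, $(\operatorname{div}u)_{n}:=u_{n+1}-u_{n}$, $(\Delta u)_{n}:=u_{n-1}-2u_{n}+u_{n+1}$. We write $\operatorname{div}^{k}u_{n}$ for $(\operatorname{div}^{k}u)_{n}$, $(-\Delta)^{j}u_n$ for $((-\Delta)^{j}u)_n$, etc.; compositions are written by juxtaposition, and the zeroth power of an operator is the identity. Half-integer powers: $(-\Delta)^{\ell/2}:=(-\Delta)^{m}$ if $\ell=2m$, and $(-\Delta)^{\ell/2}:=\nabla(-\Delta)^{m}$ if $\ell=2m+1$. $\lceil x\rceil$ is the least integer $\geq x$. Spaces: $H^{\ell}:=\{u:\mathbb{Z}\to\mathbb{C}\mid u_{n}=0\text{ for all }n<\ell\}$, and $\mathcal{H}_{0}^{\ell}:=\{u\in H^{\ell}\mid u\text{ has finite support}\}$. *)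

theory Defs
  imports "HOL-Analysis.Analysis" "HOL-Library.Complex_Order"
begin

text \<open>
  Complex numbers carry the order of HOL-Library.Complex_Order, in which
  \<open>0 < z\<close> means that \<open>z\<close> is real and strictly positive.
\<close>

type_synonym cseq = "int \<Rightarrow> complex"

definition nabla :: "cseq \<Rightarrow> cseq" where
  "nabla u = (\<lambda>n. u n - u (n - 1))"

text \<open>The operator written div in the mathematics; that name is already integer division.\<close>

definition dvg :: "cseq \<Rightarrow> cseq" where
  "dvg u = (\<lambda>n. u (n + 1) - u n)"

definition Laplace :: "cseq \<Rightarrow> cseq" where
  "Laplace u = (\<lambda>n. u (n - 1) - 2 * u n + u (n + 1))"

definition neg_Laplace :: "cseq \<Rightarrow> cseq" where
  "neg_Laplace u = (\<lambda>n. - Laplace u n)"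

text \<open>\<open>neg_Laplace_half l\<close> is the power of \<open>neg_Laplace\<close> with exponent \<open>l / 2\<close>.\<close>

definition neg_Laplace_half :: "nat \<Rightarrow> cseq \<Rightarrow> cseq" where
  "neg_Laplace_half l u =
     (if even l then (neg_Laplace ^^ (l div 2)) u
      else nabla ((neg_Laplace ^^ (l div 2)) u))"

definition H :: "nat \<Rightarrow> cseq set" where
  "H l = {u. \<forall>n < int l. u n = 0}"

definition H0 :: "nat \<Rightarrow> cseq set" where
  "H0 l = {u \<in> H l. finite {n. u n \<noteq> 0}}"

text \<open>
  For \<open>k = l - 1\<close> the quotient in front of the square is \<open>1\<close> by convention, also
  where its denominator vanishes. For finitely supported \<open>u\<close> only finitely many
  summands are nonzero, so the unordered sum is a finite one.
\<close>

definition remainder_coeff :: "nat \<Rightarrow> nat \<Rightarrow> cseq \<Rightarrow> cseq" where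
  "remainder_coeff l k g = (\<lambda>n.
     if k = l - 1 then 1
     else (neg_Laplace ^^ (l - 1 - k)) ((dvg ^^ (k + 1)) g) n / (dvg ^^ (k + 1)) g n)"

definition remainder :: "nat \<Rightarrow> nat \<Rightarrow> cseq \<Rightarrow> cseq \<Rightarrow> complex" where
  "remainder l k g u =
     (\<Sum>\<^sub>\<infinity>n\<in>{int l - int k..}.
        remainder_coeff l k g n *
        complex_of_real
          ((cmod (csqrt ((dvg ^^ k) g n / (dvg ^^ k) g (n + 1)) * (dvg ^^ k) u (n + 1)
                - csqrt ((dvg ^^ k) g (n + 1) / (dvg ^^ k) g n) * (dvg ^^ k) u n))\<^sup>2))"

end

theory Submission
  imports Defs
begin

text \<open>
  The sum over \<open>k\<close> telescopes. Interpolate between the two sides by the energies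
  \[ S_k = \sum_{n \ge \ell - k}
       \frac{(-\Delta)^{\ell-k} \mathrm{div}^k g_n}{\mathrm{div}^k g_n} \, |\mathrm{div}^k u_n|^2
     \quad (k < \ell), \qquad S_\ell = \sum_{n \ge 0} |\mathrm{div}^\ell u_n|^2 . \]
  Then \<open>S\<^sub>0\<close> is the weighted sum of \<open>|u|\<^sup>2\<close>. As the second difference is a shifted square of
  \<open>div\<close>, \<open>(-\<Delta>)\<^sup>l\<^sup>/\<^sup>2 u\<close> is up to sign a shift of \<open>div\<^sup>l u\<close>
  (\<open>neg_Laplace_half_eq_dvg_power\<close>), and \<open>S\<^sub>l\<close> is the left-hand side. It remains to see that
  the \<open>k\<close>-th remainder is \<open>S\<^sub>k\<^sub>+\<^sub>1 - S\<^sub>k\<close> (\<open>remainder_eq_energy_diff\<close>).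

  For this, put \<open>a = div\<^sup>k g\<close> and \<open>v = div\<^sup>k u\<close>, which both vanish below \<open>l - k\<close>. Expanding the
  square in the remainder gives \<open>|div v|\<^sup>2\<close> plus \<open>div a\<close> times the difference of the consecutive
  values of \<open>|v|\<^sup>2 / a\<close> (\<open>picone_pointwise\<close>). The weight of the remainder is
  \<open>b / div a\<close> with \<open>b = (-\<Delta>)\<^sup>l\<^sup>-\<^sup>1\<^sup>-\<^sup>k div a\<close>, so its denominator cancels, and summation by parts
  moves the difference from \<open>|v|\<^sup>2 / a\<close> to \<open>b\<close> (\<open>picone_sum\<close>). Since \<open>- \<nabla> b = (-\<Delta>)\<^sup>l\<^sup>-\<^sup>k a\<close>,
  this is the claim. The boundary term of the summation by parts supplies exactly the first
  summand, at \<open>n = l - k - 1\<close>, of \<open>S\<^sub>k\<^sub>+\<^sub>1\<close>.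
\<close>

section \<open>Algebra of the difference operators\<close>

lemma neg_Laplace_eq_nabla_dvg: "neg_Laplace u n = - nabla (dvg u) n"
  by (simp add: neg_Laplace_def Laplace_def nabla_def dvg_def)

lemma neg_Laplace_power_dvg: "(neg_Laplace ^^ m) (dvg u) = dvg ((neg_Laplace ^^ m) u)"
proof (induction m)
  case (Suc m)
  have "neg_Laplace (dvg w) = dvg (neg_Laplace w)" for w
    by (simp add: fun_eq_iff neg_Laplace_def Laplace_def dvg_def)
  with Suc show ?case by simp
qed simp

lemma neg_Laplace_power_eq_dvg_power:
  "(neg_Laplace ^^ m) u n = (-1) ^ m * (dvg ^^ (2 * m)) u (n - int m)"
proof (induction m arbitrary: n)
  case (Suc m)
  have lap: "neg_Laplace w n = 2 * w n - w (n - 1) - w (n + 1)"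
    and dvg2: "dvg (dvg w) n = w (n + 2) - 2 * w (n + 1) + w n" for w n
    by (simp_all add: neg_Laplace_def Laplace_def dvg_def add.assoc)
  let ?w = "(neg_Laplace ^^ m) u" and ?d = "(dvg ^^ (2 * m)) u"
  have "(neg_Laplace ^^ Suc m) u n = 2 * ?w n - ?w (n - 1) - ?w (n + 1)"
    by (simp only: funpow.simps o_def lap[of ?w n])
  also have "\<dots> = (-1) ^ Suc m * dvg (dvg ?d) (n - int (Suc m))"
    unfolding dvg2 Suc by (simp add: algebra_simps)
  finally show ?case by simp
qed simp

lemma neg_Laplace_half_eq_dvg_power:
  "neg_Laplace_half l u n = (-1) ^ (l div 2) * (dvg ^^ l) u (n - \<lceil>real l / 2\<rceil>)"
proof (cases "even l")
  case True
  then obtain m where "l = 2 * m" by blast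
  then show ?thesis
    by (simp add: neg_Laplace_half_def neg_Laplace_power_eq_dvg_power)
next
  case False
  then obtain m where m: "l = 2 * m + 1" by (elim oddE)
  have "\<lceil>real l / 2\<rceil> = int m + 1"
    by (rule ceiling_unique) (simp_all add: m)
  with m show ?thesis
    by (simp add: neg_Laplace_half_def nabla_def neg_Laplace_power_eq_dvg_power dvg_def
        algebra_simps)
qed

lemma dvg_power_in_H:
  assumes "w \<in> H l" "k \<le> l"
  shows "(dvg ^^ k) w \<in> H (l - k)"
  using assms(2)
proof (induction k)
  case (Suc k)
  then show ?case by (auto simp: H_def dvg_def)
qed (use assms in simp)

lemma finite_support_dvg:
  assumes "finite {n. u n \<noteq> 0}"
  shows "finite {n. dvg u n \<noteq> 0}"
proof (rule finite_subset)
  show "{n. dvg u n \<noteq> 0} \<subseteq> (\<lambda>n. n - 1) ` {n. u n \<noteq> 0} \<union> {n. u n \<noteq> 0}"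
    by (force simp: dvg_def image_iff)
qed (use assms in simp)

lemma finite_support_dvg_power:
  "finite {n. u n \<noteq> 0} \<Longrightarrow> finite {n. (dvg ^^ k) u n \<noteq> 0}"
  by (induction k) (simp_all add: finite_support_dvg)

section \<open>A discrete Picone identity\<close>

lemma summable_on_finite_support:
  fixes f :: "int \<Rightarrow> complex"
  assumes "finite {n. f n \<noteq> 0}"
  shows "f summable_on A"
proof -
  have "f summable_on (A \<inter> {n. f n \<noteq> 0})" using assms by simp
  then show ?thesis
    by (rule summable_on_cong_neutral[THEN iffD1, rotated -1]) auto
qed

lemma
  fixes f g :: "'a \<Rightarrow> complex"
  assumes "f summable_on A" "g summable_on A"
  shows infsum_diff: "(\<Sum>\<^sub>\<infinity>x\<in>A. f x - g x) = infsum f A - infsum g A"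
    and summable_on_diff: "(\<lambda>x. f x - g x) summable_on A"
proof -
  have g: "(\<lambda>x. - g x) summable_on A" using assms(2) by (simp add: summable_on_uminus)
  show "(\<Sum>\<^sub>\<infinity>x\<in>A. f x - g x) = infsum f A - infsum g A"
    using infsum_add[OF assms(1) g] by (simp add: infsum_uminus)
  show "(\<lambda>x. f x - g x) summable_on A"
    using summable_on_add[OF assms(1) g] by simp
qed

lemma infsum_atLeast_shift:
  fixes f :: "int \<Rightarrow> complex"
  shows "(\<Sum>\<^sub>\<infinity>n\<in>{p..}. f n) = (\<Sum>\<^sub>\<infinity>n\<in>{p + c..}. f (n - c))"
proof -
  have "{p..} = (\<lambda>n. n - c) ` {p + c..}"
    by (auto simp: image_iff intro!: bexI[of _ "_ + c"])
  then show ?thesis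
    by (simp add: infsum_reindex inj_on_def o_def)
qed

text \<open>
  In both the real and the imaginary part the square expands to
  \<open>(r / s) B\<^sup>2 - 2 A B + (s / r) A\<^sup>2\<close>, because the two roots are inverse to each other; so
  only the pure squares differ from those of \<open>(B - A)\<^sup>2\<close>.
\<close>

lemma picone_pointwise:
  fixes r s :: real and x y :: complex
  assumes "r > 0" "s > 0"
  shows "(cmod (sqrt (r / s) * y - sqrt (s / r) * x))\<^sup>2
       = (cmod (y - x))\<^sup>2 + (s - r) * ((cmod x)\<^sup>2 / r - (cmod y)\<^sup>2 / s)"
proof -
  have real_case: "(sqrt (r / s) * B - sqrt (s / r) * A)\<^sup>2
      = (B - A)\<^sup>2 + (s - r) * (A\<^sup>2 / r - B\<^sup>2 / s)" for A B
  proof -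
    have prod: "sqrt (r / s) * sqrt (s / r) = 1"
      using assms by (simp flip: real_sqrt_mult)
    have "(sqrt (r / s) * B - sqrt (s / r) * A)\<^sup>2
        = (sqrt (r / s))\<^sup>2 * B\<^sup>2 + (sqrt (s / r))\<^sup>2 * A\<^sup>2
          - 2 * (sqrt (r / s) * sqrt (s / r)) * A * B"
      by (simp add: power2_eq_square algebra_simps)
    also have "\<dots> = (r / s) * B\<^sup>2 + (s / r) * A\<^sup>2 - 2 * A * B"
      using assms prod by simp
    also have "\<dots> = (B - A)\<^sup>2 + (s - r) * (A\<^sup>2 / r - B\<^sup>2 / s)"
      using assms by (simp add: field_simps power2_eq_square)
    finally show ?thesis .
  qed
  show ?thesis
    by (simp add: cmod_power2 real_case add_divide_distrib) (simp only: algebra_simps)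
qed

text \<open>
  With \<open>q = |v|\<^sup>2 / a\<close>, the \<open>n\<close>-th summand on the left is
  \<open>W n \<cdot> |dvg v n|\<^sup>2 + b n \<cdot> q n - b n \<cdot> q (n + 1)\<close>. This expression vanishes at \<open>n = p - 1\<close>,
  because \<open>a\<close> and \<open>v\<close> are zero there, so the sum can be started at \<open>p - 1\<close>; summation by
  parts then leaves no boundary term. The hypothesis on \<open>b\<close> is a product, not \<open>W = b / dvg a\<close>,
  so that it also covers \<open>W = 1\<close> and \<open>b = dvg a\<close> with zeros of \<open>dvg a\<close>.
\<close>

lemma picone_sum:
  fixes a b v W :: cseq and p :: int
  assumes pos: "\<And>n. n \<ge> p \<Longrightarrow> a n > 0" and a0: "a (p - 1) = 0"
    and fin: "finite {n. v n \<noteq> 0}" and v0: "v (p - 1) = 0"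
    and b: "\<And>n. n \<ge> p - 1 \<Longrightarrow> W n * dvg a n = b n"
  shows "(\<Sum>\<^sub>\<infinity>n\<in>{p..}. W n * complex_of_real
            ((cmod (csqrt (a n / a (n + 1)) * v (n + 1) - csqrt (a (n + 1) / a n) * v n))\<^sup>2))
       = (\<Sum>\<^sub>\<infinity>n\<in>{p - 1..}. W n * complex_of_real ((cmod (dvg v n))\<^sup>2))
         + (\<Sum>\<^sub>\<infinity>n\<in>{p..}. nabla b n / a n * complex_of_real ((cmod (v n))\<^sup>2))"
proof -
  define q where "q n = complex_of_real ((cmod (v n))\<^sup>2) / a n" for n
  define E where "E n = W n * complex_of_real ((cmod (dvg v n))\<^sup>2)" for n
  define F where "F n = b n * q n" for n
  define G where "G n = b (n - 1) * q n" for n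
  define T where "T n = W n * complex_of_real
     ((cmod (csqrt (a n / a (n + 1)) * v (n + 1) - csqrt (a (n + 1) / a n) * v n))\<^sup>2)" for n
  have q0: "q (p - 1) = 0" by (simp add: q_def v0)
  have T: "T n = E n + (F n - G (n + 1))" if "n \<ge> p" for n
  proof -
    have "a n > 0" "a (n + 1) > 0" using pos that by simp_all
    then obtain r s where rs: "a n = complex_of_real r" "r > 0"
        "a (n + 1) = complex_of_real s" "s > 0"
      by (metis complex_is_Real_iff less_complex_def of_real_Re zero_complex.simps)
    have roots: "csqrt (a n / a (n + 1)) = sqrt (r / s)" "csqrt (a (n + 1) / a n) = sqrt (s / r)"
      using rs by (simp_all add: csqrt_of_real flip: of_real_divide)
    have "T n = E n + W n * ((complex_of_real s - complex_of_real r) * (q n - q (n + 1)))"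
      unfolding T_def roots
      unfolding picone_pointwise[OF rs(2,4)] E_def q_def dvg_def
        rs(1,3)
      by (simp add: distrib_left)
    then have "T n = E n + W n * dvg a n * (q n - q (n + 1))"
      by (simp add: dvg_def rs mult.assoc)
    then show ?thesis using b[of n] that by (simp add: F_def G_def algebra_simps)
  qed
  have bdry: "E (p - 1) + (F (p - 1) - G p) = 0"
  proof -
    have "a p \<noteq> 0" using pos[of p] by auto
    moreover have "b (p - 1) = W (p - 1) * a p" using b[of "p - 1"] a0 by (simp add: dvg_def)
    ultimately show ?thesis by (simp add: E_def F_def G_def q0 dvg_def v0 q_def)
  qed
  have finq: "finite {n. q n \<noteq> 0}"
    by (rule finite_subset[OF _ fin]) (auto simp: q_def)
  have "finite {n. E n \<noteq> 0}"
    by (rule finite_subset[OF _ finite_support_dvg[OF fin]]) (auto simp: E_def)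
  moreover have "finite {n. F n \<noteq> 0}" "finite {n. G n \<noteq> 0}"
    by (rule finite_subset[OF _ finq]; auto simp: F_def G_def)+
  ultimately have summable: "E summable_on A" "F summable_on A" "G summable_on A" for A
    by (simp_all add: summable_on_finite_support)
  have summable_shift: "(\<lambda>n. G (n + 1)) summable_on A" for A
  proof (rule summable_on_finite_support, rule finite_subset)
    show "{n. G (n + 1) \<noteq> 0} \<subseteq> (\<lambda>n. n - 1) ` {n. q n \<noteq> 0}"
      by (force simp: G_def image_iff)
  qed (use finq in simp)
  have "(\<Sum>\<^sub>\<infinity>n\<in>{p..}. T n) = (\<Sum>\<^sub>\<infinity>n\<in>{p - 1..}. E n + (F n - G (n + 1)))"
  proof (rule infsum_cong_neutral)
    fix n assume "n \<in> {p - 1..} - {p..}"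
    then have "n = p - 1" by auto
    with bdry show "E n + (F n - G (n + 1)) = 0" by simp
  qed (use T in auto)
  also have "\<dots> = (\<Sum>\<^sub>\<infinity>n\<in>{p - 1..}. E n)
      + ((\<Sum>\<^sub>\<infinity>n\<in>{p - 1..}. F n) - (\<Sum>\<^sub>\<infinity>n\<in>{p - 1..}. G (n + 1)))"
    by (simp add: infsum_add infsum_diff summable summable_on_diff summable_shift)
  also have "(\<Sum>\<^sub>\<infinity>n\<in>{p - 1..}. F n) = (\<Sum>\<^sub>\<infinity>n\<in>{p..}. F n)"
  proof (rule infsum_cong_neutral)
    fix n assume "n \<in> {p - 1..} - {p..}"
    then have "n = p - 1" by auto
    with q0 show "F n = 0" by (simp add: F_def)
  qed auto
  also have "(\<Sum>\<^sub>\<infinity>n\<in>{p - 1..}. G (n + 1)) = (\<Sum>\<^sub>\<infinity>n\<in>{p..}. G n)"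
    by (subst infsum_atLeast_shift[where c = 1]) simp
  also have "(\<Sum>\<^sub>\<infinity>n\<in>{p..}. F n) - (\<Sum>\<^sub>\<infinity>n\<in>{p..}. G n) = (\<Sum>\<^sub>\<infinity>n\<in>{p..}. F n - G n)"
    by (simp add: infsum_diff summable)
  also have "(\<lambda>n. F n - G n)
      = (\<lambda>n. nabla b n / a n * complex_of_real ((cmod (v n))\<^sup>2))"
    by (simp add: fun_eq_iff F_def G_def q_def nabla_def field_simps diff_divide_distrib)
  finally show ?thesis unfolding T_def E_def .
qed

section \<open>Telescoping energies\<close>

text \<open>
  The quotient is \<open>1\<close> at \<open>k = l\<close> by convention, as \<open>(dvg ^^ l) g\<close> may have zeros. With this
  convention the weight of the \<open>k\<close>-th remainder is the weight of the energy of index \<open>k + 1\<close>.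
\<close>

definition energy_weight :: "nat \<Rightarrow> nat \<Rightarrow> cseq \<Rightarrow> cseq" where
  "energy_weight l k g n =
     (if k = l then 1 else (neg_Laplace ^^ (l - k)) ((dvg ^^ k) g) n / (dvg ^^ k) g n)"

definition energy :: "nat \<Rightarrow> nat \<Rightarrow> cseq \<Rightarrow> cseq \<Rightarrow> complex" where
  "energy l k g u =
     (\<Sum>\<^sub>\<infinity>n\<in>{int l - int k..}.
        energy_weight l k g n * complex_of_real ((cmod ((dvg ^^ k) u n))\<^sup>2))"

lemma remainder_eq_energy_diff:
  assumes g: "g \<in> H l" and u: "u \<in> H0 l" and k: "k < l"
    and pos: "\<And>j n. j < l \<Longrightarrow> n \<ge> int l - int j \<Longrightarrow> (dvg ^^ j) g n > 0"
  shows "remainder l k g u = energy l (Suc k) g u - energy l k g u"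
proof -
  let ?a = "(dvg ^^ k) g" and ?v = "(dvg ^^ k) u" and ?p = "int l - int k"
  define b where "b = (neg_Laplace ^^ (l - Suc k)) (dvg ?a)"
  have b: "energy_weight l (Suc k) g n * dvg ?a n = b n" if "n \<ge> ?p - 1" for n
  proof (cases "Suc k = l")
    case True
    then show ?thesis by (auto simp: energy_weight_def b_def)
  next
    case False
    then have "dvg ?a n > 0" using pos[of "Suc k" n] k that by simp
    then have "dvg ?a n \<noteq> 0" by auto
    with False show ?thesis by (simp add: energy_weight_def b_def)
  qed
  have nb: "nabla b n = - (neg_Laplace ^^ (l - k)) ?a n" for n
  proof -
    have "(neg_Laplace ^^ (l - k)) ?a = neg_Laplace ((neg_Laplace ^^ (l - Suc k)) ?a)"
      using k by (simp add: Suc_diff_Suc flip: funpow.simps(2)[unfolded o_def, THEN fun_cong])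
    then show ?thesis
      by (simp add: b_def neg_Laplace_power_dvg neg_Laplace_eq_nabla_dvg)
  qed
  have zero: "?a (?p - 1) = 0" "?v (?p - 1) = 0"
    using dvg_power_in_H[of g l k] dvg_power_in_H[of u l k] g u k by (simp_all add: H0_def H_def)
  have coeff: "remainder_coeff l k g = energy_weight l (Suc k) g"
    using k by (auto simp: fun_eq_iff remainder_coeff_def energy_weight_def)
  have "remainder l k g u
      = (\<Sum>\<^sub>\<infinity>n\<in>{?p - 1..}.
           energy_weight l (Suc k) g n * complex_of_real ((cmod (dvg ?v n))\<^sup>2))
        + (\<Sum>\<^sub>\<infinity>n\<in>{?p..}. nabla b n / ?a n * complex_of_real ((cmod (?v n))\<^sup>2))"
    unfolding remainder_def coeff
    using u by (intro picone_sum pos k zero b finite_support_dvg_power) (auto simp: H0_def)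
  also have "(\<Sum>\<^sub>\<infinity>n\<in>{?p..}. nabla b n / ?a n * complex_of_real ((cmod (?v n))\<^sup>2))
      = - energy l k g u"
    using k by (simp add: energy_def energy_weight_def nb flip: infsum_uminus)
  finally show ?thesis
    by (simp add: energy_def algebra_simps)
qed

theorem theorem1:
  fixes l :: nat and g u :: "int \<Rightarrow> complex"
  assumes "l \<ge> 1"
    and "g \<in> H l"
    and "\<And>k n. k < l \<Longrightarrow> n \<ge> int l - int k \<Longrightarrow> (dvg ^^ k) g n > 0"
    and "u \<in> H0 l"
  shows "(\<Sum>\<^sub>\<infinity>n\<in>{\<lceil>real l / 2\<rceil>..}. complex_of_real ((cmod (neg_Laplace_half l u n))\<^sup>2)) =
    (\<Sum>\<^sub>\<infinity>n\<in>{int l..}.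
       (neg_Laplace ^^ l) g n / g n * complex_of_real ((cmod (u n))\<^sup>2)) +
    (\<Sum>k = 0..l - 1. remainder l k g u)"
proof -
  have "(\<Sum>\<^sub>\<infinity>n\<in>{\<lceil>real l / 2\<rceil>..}. complex_of_real ((cmod (neg_Laplace_half l u n))\<^sup>2))
      = energy l l g u"
    unfolding energy_def energy_weight_def neg_Laplace_half_eq_dvg_power
    by (subst (2) infsum_atLeast_shift[where c = "\<lceil>real l / 2\<rceil>"])
      (simp add: norm_mult norm_power)
  also have "\<dots> = energy l 0 g u + (\<Sum>k<l. energy l (Suc k) g u - energy l k g u)"
    by (simp add: sum_lessThan_telescope[of "\<lambda>k. energy l k g u"])
  also have "(\<Sum>k<l. energy l (Suc k) g u - energy l k g u) = (\<Sum>k<l. remainder l k g u)"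
    by (intro sum.cong refl remainder_eq_energy_diff[symmetric] assms) simp_all
  also have "{..<l} = {0..l - 1}" using assms(1) by auto
  also have "energy l 0 g u
      = (\<Sum>\<^sub>\<infinity>n\<in>{int l..}. (neg_Laplace ^^ l) g n / g n * complex_of_real ((cmod (u n))\<^sup>2))"
    using assms(1) by (simp add: energy_def energy_weight_def)
  finally show ?thesis .
qed

end
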